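(* Let $\mathbb{A}$ be a left (resp. right) alternative complex topological algebra with identity whose topological dual separates its points (e.g. a complex left (resp. right) alternative unital lmc algebra, or a complex left (resp. right) alternative continuous inverse algebra). Then $\sigma(a)\neq\emptyset$ for all $a\in\mathbb{A}$.
   Context: Algebras are nonzero and not necessarily associative, commutative or unital. An algebra is left (resp. right) alternative if $a(ab)=(aa)b$ (resp. $a(bb)=(ab)b$) for all $a,b$. In a unital algebra (identity $1\ne0$) an element $a$ is invertible if there is a unique element $a^{-1}$ with $aa^{-1}=a^{-1}a=1$; $\mathbb{A}^{-1}$ is the set of invertible elements. A topological complex algebra is a complex algebra with a Hausdorff topology such that addition and scalar multiplication are continuous, multiplication is separately continuous, and inversion on $\mathbb{A}^{-1}$ is continuous. Its topological dual $\mathbb{A}^*$ is the space of continuous linear functionals on $\mathbb{A}$. An lmc (locally multiplicatively convex) algebra is an algebra that is a (Hausdorff) locally convex space whose topology is generated by submultiplicative seminorms. A continuous inverse algebra is a locally convex unital topological algebra with $\mathbb{A}^{-1}$ open and inversion continuous. The spectrum of $a$ is $\sigma(a)=\{z\in\mathbb{C}: z1-a\notin\mathbb{A}^{-1}\}$. *)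

theory Defs
  imports Complex_Main
begin

text \<open>The multiplication and the identity are explicit parameters because the
  library type classes for rings presuppose associativity.\<close>

locale complex_algebra =
  vector_space scale
  for scale :: "complex \<Rightarrow> 'a::ab_group_add \<Rightarrow> 'a" +
  fixes mult :: "'a \<Rightarrow> 'a \<Rightarrow> 'a" (infixl \<open>\<odot>\<close> 70)
  assumes linear_mult_right: "Vector_Spaces.linear scale scale (\<lambda>b. a \<odot> b)"
    and linear_mult_left: "Vector_Spaces.linear scale scale (\<lambda>a. a \<odot> b)"

locale unital_complex_algebra =
  complex_algebra scale mult
  for scale :: "complex \<Rightarrow> 'a::ab_group_add \<Rightarrow> 'a"
    and mult :: "'a \<Rightarrow> 'a \<Rightarrow> 'a" (infixl \<open>\<odot>\<close> 70) +
  fixes one :: 'a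
  assumes one_mult: "one \<odot> a = a"
    and mult_one: "a \<odot> one = a"
    and one_neq_zero: "one \<noteq> 0"

definition left_alternative :: "('a \<Rightarrow> 'a \<Rightarrow> 'a) \<Rightarrow> bool" where
  "left_alternative mult \<longleftrightarrow> (\<forall>a b. mult a (mult a b) = mult (mult a a) b)"

definition right_alternative :: "('a \<Rightarrow> 'a \<Rightarrow> 'a) \<Rightarrow> bool" where
  "right_alternative mult \<longleftrightarrow> (\<forall>a b. mult a (mult b b) = mult (mult a b) b)"

text \<open>Without associativity a two-sided inverse need not be unique, so uniqueness is
  part of the notion of invertibility.\<close>

definition alg_units :: "('a \<Rightarrow> 'a \<Rightarrow> 'a) \<Rightarrow> 'a \<Rightarrow> 'a set" where
  "alg_units mult one = {a. \<exists>!b. mult a b = one \<and> mult b a = one}"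

definition alg_inverse :: "('a \<Rightarrow> 'a \<Rightarrow> 'a) \<Rightarrow> 'a \<Rightarrow> 'a \<Rightarrow> 'a" where
  "alg_inverse mult one a = (THE b. mult a b = one \<and> mult b a = one)"

definition alg_spectrum ::
  "(complex \<Rightarrow> 'a \<Rightarrow> 'a) \<Rightarrow> ('a \<Rightarrow> 'a \<Rightarrow> 'a) \<Rightarrow> 'a \<Rightarrow> 'a::ab_group_add \<Rightarrow> complex set" where
  "alg_spectrum scale mult one a = {z. scale z one - a \<notin> alg_units mult one}"

text \<open>The Hausdorff property and the joint continuity of addition are carried by the
  sort of the underlying type.  Multiplication is only separately continuous.\<close>

locale topological_unital_complex_algebra =
  unital_complex_algebra scale mult one
  for scale :: "complex \<Rightarrow> 'a::{topological_ab_group_add, t2_space} \<Rightarrow> 'a"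
    and mult :: "'a \<Rightarrow> 'a \<Rightarrow> 'a" (infixl \<open>\<odot>\<close> 70)
    and one :: 'a +
  assumes continuous_scale: "continuous_on UNIV (\<lambda>(z, a). scale z a)"
    and continuous_mult_right: "continuous_on UNIV (\<lambda>b. a \<odot> b)"
    and continuous_mult_left: "continuous_on UNIV (\<lambda>a. a \<odot> b)"
    and continuous_inverse: "continuous_on (alg_units mult one) (alg_inverse mult one)"

definition topological_dual ::
  "(complex \<Rightarrow> 'a::{ab_group_add, topological_space} \<Rightarrow> 'a) \<Rightarrow> ('a \<Rightarrow> complex) set" where
  "topological_dual scale = {f. Vector_Spaces.linear scale (*) f \<and> continuous_on UNIV f}"

definition dual_separates_points ::
  "(complex \<Rightarrow> 'a::{ab_group_add, topological_space} \<Rightarrow> 'a) \<Rightarrow> bool" where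
  "dual_separates_points scale \<longleftrightarrow>
    (\<forall>x y. x \<noteq> y \<longrightarrow> (\<exists>f\<in>topological_dual scale. f x \<noteq> f y))"

definition complex_seminorm ::
  "(complex \<Rightarrow> 'a \<Rightarrow> 'a) \<Rightarrow> ('a::ab_group_add \<Rightarrow> real) \<Rightarrow> bool" where
  "complex_seminorm scale p \<longleftrightarrow>
    (\<forall>x y. p (x + y) \<le> p x + p y) \<and> (\<forall>z x. p (scale z x) = cmod z * p x)"

definition submultiplicative :: "('a \<Rightarrow> 'a \<Rightarrow> 'a) \<Rightarrow> ('a \<Rightarrow> real) \<Rightarrow> bool" where
  "submultiplicative mult p \<longleftrightarrow> (\<forall>x y. p (mult x y) \<le> p x * p y)"

definition topology_generated_by_seminorms ::
  "('a::{ab_group_add, topological_space} \<Rightarrow> real) set \<Rightarrow> bool" where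
  "topology_generated_by_seminorms P \<longleftrightarrow>
    (open :: 'a set \<Rightarrow> bool) =
      generate_topology {{y. p (y - x) < e} | p x e. p \<in> P \<and> 0 < e}"

locale lmc_unital_complex_algebra =
  unital_complex_algebra scale mult one
  for scale :: "complex \<Rightarrow> 'a::{topological_ab_group_add, t2_space} \<Rightarrow> 'a"
    and mult :: "'a \<Rightarrow> 'a \<Rightarrow> 'a" (infixl \<open>\<odot>\<close> 70)
    and one :: 'a +
  assumes submultiplicative_seminorms:
    "\<exists>P. (\<forall>p\<in>P. complex_seminorm scale p \<and> submultiplicative mult p) \<and>
         topology_generated_by_seminorms P"

locale continuous_inverse_complex_algebra =
  topological_unital_complex_algebra scale mult one
  for scale :: "complex \<Rightarrow> 'a::{topological_ab_group_add, t2_space} \<Rightarrow> 'a"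
    and mult :: "'a \<Rightarrow> 'a \<Rightarrow> 'a" (infixl \<open>\<odot>\<close> 70)
    and one :: 'a +
  assumes locally_convex:
    "\<exists>P. (\<forall>p\<in>P. complex_seminorm scale p) \<and> topology_generated_by_seminorms P"
    and open_units: "open (alg_units mult one)"

end

theory Submission
  imports Defs "HOL-Complex_Analysis.Complex_Analysis"
begin

text \<open>
  Linearizing the left alternative law shows that a two-sided inverse pair \<open>a b = b a = 1\<close>
  already satisfies \<open>a (b c) = c\<close>, so left multiplication by \<open>a\<inverse>\<close> inverts left
  multiplication by \<open>a\<close>.  This replaces associativity in the resolvent equation, and the
  classical argument goes through: if the spectrum of \<open>a\<close> were empty, then \<open>f ((z - a)\<inverse>)\<close>
  would be an entire function of \<open>z\<close> vanishing at infinity for each continuous functional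
  \<open>f\<close>, hence zero by Liouville, and so \<open>(z - a)\<inverse> = 0\<close>.  The right alternative case follows by
  passing to the opposite algebra.
\<close>

section \<open>Alternative algebras\<close>

context complex_algebra
begin

lemma mult_add_right: "a \<odot> (b + c) = a \<odot> b + a \<odot> c"
  and mult_diff_right: "a \<odot> (b - c) = a \<odot> b - a \<odot> c"
  and mult_scale_right: "a \<odot> scale z b = scale z (a \<odot> b)"
  and right_mult_zero: "a \<odot> 0 = 0"
proof -
  interpret Vector_Spaces.linear scale scale "\<lambda>b. a \<odot> b"
    by (rule linear_mult_right)
  show "a \<odot> (b + c) = a \<odot> b + a \<odot> c" "a \<odot> (b - c) = a \<odot> b - a \<odot> c"
    "a \<odot> scale z b = scale z (a \<odot> b)" "a \<odot> 0 = 0"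
    by (fact add diff scale zero)+
qed

lemma mult_add_left: "(a + b) \<odot> c = a \<odot> c + b \<odot> c"
  and mult_diff_left: "(a - b) \<odot> c = a \<odot> c - b \<odot> c"
  and mult_scale_left: "scale z a \<odot> b = scale z (a \<odot> b)"
proof -
  interpret Vector_Spaces.linear scale scale "\<lambda>a. a \<odot> d" for d
    by (rule linear_mult_left)
  show "(a + b) \<odot> c = a \<odot> c + b \<odot> c" "(a - b) \<odot> c = a \<odot> c - b \<odot> c"
    "scale z a \<odot> b = scale z (a \<odot> b)"
    by (fact add diff scale)+
qed

text \<open>Linearization only yields identities between doubled elements; 2 is an invertible
  scalar, so the factor can be cancelled.\<close>

lemma double_eq_imp_eq:
  fixes x y :: 'a
  assumes "x + x = y + y"
  shows "x = y"
proof -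
  have "scale 2 x = scale 2 y"
    using assms scale_left_distrib[of 1 1 x] scale_left_distrib[of 1 1 y] by simp
  then show ?thesis by simp
qed

end

section \<open>The opposite algebra\<close>

context
  fixes scale :: "complex \<Rightarrow> 'a::ab_group_add \<Rightarrow> 'a"
    and mult :: "'a \<Rightarrow> 'a \<Rightarrow> 'a"
    and one :: 'a
begin

lemma unital_complex_algebra_opposite:
  "unital_complex_algebra scale mult one \<Longrightarrow> unital_complex_algebra scale (\<lambda>a b. mult b a) one"
  unfolding unital_complex_algebra_def unital_complex_algebra_axioms_def
    complex_algebra_def complex_algebra_axioms_def
  by blast

lemma alg_units_opposite: "alg_units (\<lambda>a b. mult b a) one = alg_units mult one"
  by (simp add: alg_units_def conj_commute)

lemma alg_inverse_opposite: "alg_inverse (\<lambda>a b. mult b a) one = alg_inverse mult one"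
  by (simp add: alg_inverse_def conj_commute fun_eq_iff)

lemma alg_spectrum_opposite:
  "alg_spectrum scale (\<lambda>a b. mult b a) one = alg_spectrum scale mult one"
  by (simp add: alg_spectrum_def alg_units_opposite fun_eq_iff)

lemma left_alternative_opposite:
  "left_alternative (\<lambda>a b. mult b a) \<longleftrightarrow> right_alternative mult"
  by (auto simp: left_alternative_def right_alternative_def)

end

context
  fixes scale :: "complex \<Rightarrow> 'a::{topological_ab_group_add, t2_space} \<Rightarrow> 'a"
    and mult :: "'a \<Rightarrow> 'a \<Rightarrow> 'a"
    and one :: 'a
begin

lemma topological_unital_complex_algebra_opposite:
  "topological_unital_complex_algebra scale mult one \<Longrightarrow>
    topological_unital_complex_algebra scale (\<lambda>a b. mult b a) one"
  unfolding topological_unital_complex_algebra_def topological_unital_complex_algebra_axioms_def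
    alg_units_opposite[of mult one] alg_inverse_opposite[of mult one]
  by (intro conjI unital_complex_algebra_opposite[of scale mult one]) auto

lemma lmc_unital_complex_algebra_opposite:
  assumes "lmc_unital_complex_algebra scale mult one"
  shows "lmc_unital_complex_algebra scale (\<lambda>a b. mult b a) one"
proof -
  have "submultiplicative (\<lambda>a b. mult b a) p = submultiplicative mult p" for p
    unfolding submultiplicative_def by (metis mult.commute)
  then show ?thesis
    using assms unital_complex_algebra_opposite[of scale mult one]
    unfolding lmc_unital_complex_algebra_def lmc_unital_complex_algebra_axioms_def by auto
qed

end

lemma alg_inverse_mult:
  fixes mult :: "'a \<Rightarrow> 'a \<Rightarrow> 'a"
  assumes "a \<in> alg_units mult one"
  shows "mult a (alg_inverse mult one a) = one" "mult (alg_inverse mult one a) a = one"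
  using theI'[of "\<lambda>b. mult a b = one \<and> mult b a = one"] assms
  by (auto simp: alg_units_def alg_inverse_def)

section \<open>Inverses and the resolvent equation without associativity\<close>

locale left_alternative_algebra = unital_complex_algebra scale mult one
  for scale :: "complex \<Rightarrow> 'a::ab_group_add \<Rightarrow> 'a"
    and mult :: "'a \<Rightarrow> 'a \<Rightarrow> 'a" (infixl \<open>\<odot>\<close> 70)
    and one :: 'a +
  assumes left_alternative: "left_alternative mult"
begin

abbreviation inv' where "inv' \<equiv> alg_inverse mult one"
abbreviation units where "units \<equiv> alg_units mult one"

lemma left_alt: "a \<odot> (a \<odot> b) = a \<odot> a \<odot> b"
  using left_alternative by (simp add: left_alternative_def)

text \<open>Polarization: put \<open>a + b\<close> into \<open>left_alt\<close> and subtract the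
  instances for \<open>a\<close> and \<open>b\<close>.\<close>

lemma left_alt_linearized: "a \<odot> (b \<odot> c) + b \<odot> (a \<odot> c) = a \<odot> b \<odot> c + b \<odot> a \<odot> c"
  using left_alt[of "a + b" c] left_alt[of a c] left_alt[of b c]
  by (simp add: mult_add_left mult_add_right algebra_simps)

lemma inverse_pair_double:
  assumes "a \<odot> b = one" "b \<odot> a = one"
  shows "a \<odot> (b \<odot> c) + b \<odot> (a \<odot> c) = c + c"
  using left_alt_linearized[of a b c] assms by (simp add: one_mult)

text \<open>In terms of left multiplications this is
  \<open>L\<^sub>b L\<^sub>a L\<^sub>b = L\<^sub>b\<close>. Polarizing with \<open>a\<close> and
  \<open>b \<odot> b\<close>, and multiplying
  \<open>L\<^sub>a L\<^sub>b + L\<^sub>b L\<^sub>a = 2\<close> by \<open>L\<^sub>b\<close> on either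
  side, gives three expressions for \<open>2 L\<^sub>b\<close>; comparing them leaves twice the
  claim.\<close>

lemma inverse_pair_regular:
  assumes "a \<odot> b = one" "b \<odot> a = one"
  shows "b \<odot> (a \<odot> (b \<odot> c)) = b \<odot> c"
proof -
  note double = inverse_pair_double[OF assms]
  have "a \<odot> (b \<odot> b) = b"
    using double[of b] assms by (simp add: mult_one)
  moreover have "b \<odot> b \<odot> a = b"
    using left_alt[of b a] assms by (simp add: mult_one)
  \<comment> \<open>The two products of \<open>a\<close> with \<open>b \<odot> b\<close> are both
    \<open>b\<close>, so the right side of the polarized law is
    \<open>b \<odot> c + b \<odot> c\<close>; on the left, multiplication by
    \<open>b \<odot> b\<close> is multiplying twice by \<open>b\<close>.\<close>
  ultimately have "a \<odot> (b \<odot> (b \<odot> c)) + b \<odot> (b \<odot> (a \<odot> c)) = b \<odot> c + b \<odot> c"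
    using left_alt_linearized[of a "b \<odot> b" c] by (simp add: left_alt)
  moreover have "a \<odot> (b \<odot> (b \<odot> c)) + b \<odot> (a \<odot> (b \<odot> c)) = b \<odot> c + b \<odot> c"
    by (rule double)
  moreover have "b \<odot> (a \<odot> (b \<odot> c)) + b \<odot> (b \<odot> (a \<odot> c)) = b \<odot> c + b \<odot> c"
    by (metis double mult_add_right)
  ultimately have "b \<odot> (a \<odot> (b \<odot> c)) + b \<odot> (a \<odot> (b \<odot> c)) = b \<odot> c + b \<odot> c"
    by (metis add.commute add_left_imp_eq)
  then show ?thesis by (rule double_eq_imp_eq)
qed

text \<open>The left multiplications \<open>L\<^sub>a\<close> and \<open>L\<^sub>b\<close> give idempotents \<open>E = L\<^sub>a L\<^sub>b\<close> and \<open>F = L\<^sub>b L\<^sub>a\<close>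
  with \<open>E + F = 2\<close>, which forces \<open>E = F = 1\<close>.\<close>

lemma inverse_pair_cancel:
  assumes "a \<odot> b = one" "b \<odot> a = one"
  shows "a \<odot> (b \<odot> c) = c"
proof -
  define E where "E = a \<odot> (b \<odot> c)"
  define F where "F = b \<odot> (a \<odot> c)"
  have EF: "E + F = c + c"
    using inverse_pair_double[OF assms] by (simp add: E_def F_def)
  \<comment> \<open>\<open>E\<close> and \<open>F\<close> are the values of the two idempotents at
    \<open>c\<close>. Applying \<open>L\<^sub>b L\<^sub>a\<close>, which fixes \<open>F\<close>, to
    \<open>E + F = c + c\<close> shows that it maps \<open>E\<close> to \<open>F\<close>.\<close>
  have "b \<odot> (a \<odot> E) + b \<odot> (a \<odot> F) = b \<odot> (a \<odot> c) + b \<odot> (a \<odot> c)"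
    using EF by (metis mult_add_right)
  moreover have "b \<odot> (a \<odot> F) = F"
    using inverse_pair_regular[OF assms(2,1), of c] by (simp add: F_def)
  ultimately have "b \<odot> (a \<odot> E) = F"
    by (simp add: F_def)
  moreover have "a \<odot> (b \<odot> E) = E"
    using inverse_pair_regular[OF assms, of c] by (simp add: E_def)
  ultimately have "E + E = E + F"
    using inverse_pair_double[OF assms, of E] by simp
  then have "E + E = c + c" using EF by simp
  then show ?thesis unfolding E_def by (rule double_eq_imp_eq)
qed

text \<open>Cancelling \<open>a\<close> on the left by means of \<open>b\<close> turns
  \<open>a \<odot> c = one\<close> into \<open>c = b\<close>, which supplies the uniqueness built
  into \<open>alg_units\<close>.\<close>

lemma unitI:
  assumes "a \<odot> b = one" "b \<odot> a = one"
  shows "a \<in> units" "inv' a = b"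
proof -
  have "c = b" if "a \<odot> c = one" for c
    using inverse_pair_cancel[OF assms(2,1), of c] that by (simp add: mult_one)
  then show "a \<in> units" "inv' a = b"
    using assms unfolding alg_units_def alg_inverse_def by (blast intro: the_equality)+
qed

text \<open>The bracketing lets both terms simplify: the inner product is
  \<open>one - u \<odot> inv' v\<close>, and
  \<open>inv' u \<odot> (u \<odot> inv' v) = inv' v\<close> by
  \<open>inverse_pair_cancel\<close>.\<close>

lemma inverse_diff:
  assumes "u \<in> units" "v \<in> units"
  shows "inv' u - inv' v = inv' u \<odot> ((v - u) \<odot> inv' v)"
  using alg_inverse_mult[OF assms(1)] alg_inverse_mult[OF assms(2)]
    inverse_pair_cancel[of "inv' u" u "inv' v"]
  by (simp add: mult_diff_left mult_diff_right mult_one)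

text \<open>The difference of the two shifted elements is a multiple of \<open>one\<close>, so the
  middle factor in \<open>inverse_diff\<close> becomes a scalar.\<close>

lemma resolvent_equation:
  assumes "scale z one - a \<in> units" "scale w one - a \<in> units"
  shows "inv' (scale z one - a) - inv' (scale w one - a) =
    scale (w - z) (inv' (scale z one - a) \<odot> inv' (scale w one - a))"
proof -
  have "(scale w one - a) - (scale z one - a) = scale (w - z) one"
    by (simp add: scale_left_diff_distrib)
  then show ?thesis
    using inverse_diff[OF assms]
    by (simp only: mult_scale_left mult_scale_right one_mult)
qed

text \<open>Prepares the limit at infinity: after rescaling, the element to be inverted is close to
  \<open>one\<close>, where continuity of inversion applies.\<close>

lemma inverse_scaled:
  assumes "scale z one - a \<in> units" "z \<noteq> 0"
  shows "one - scale (inverse z) a \<in> units"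
    "inv' (one - scale (inverse z) a) = scale z (inv' (scale z one - a))"
proof -
  have "one - scale (inverse z) a = scale (inverse z) (scale z one - a)"
    using assms(2) by (simp add: scale_right_diff_distrib)
  then have "(one - scale (inverse z) a) \<odot> scale z (inv' (scale z one - a)) = one"
    "scale z (inv' (scale z one - a)) \<odot> (one - scale (inverse z) a) = one"
    using alg_inverse_mult[OF assms(1)] assms(2)
    by (simp_all add: mult_scale_left mult_scale_right)
  then show "one - scale (inverse z) a \<in> units"
    "inv' (one - scale (inverse z) a) = scale z (inv' (scale z one - a))"
    by (rule unitI)+
qed

end

section \<open>Nonempty spectrum\<close>

locale topological_left_alternative_algebra =
  topological_unital_complex_algebra scale mult one + left_alternative_algebra scale mult one
  for scale :: "complex \<Rightarrow> 'a::{topological_ab_group_add, t2_space} \<Rightarrow> 'a"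
    and mult :: "'a \<Rightarrow> 'a \<Rightarrow> 'a" (infixl \<open>\<odot>\<close> 70)
    and one :: 'a
begin

lemma continuous_on_scale_left: "continuous_on S (\<lambda>z. scale z b)"
  using continuous_on_compose2[OF continuous_scale, of S "\<lambda>z. (z, b)"]
  by (simp add: continuous_intros)

abbreviation resolvent where "resolvent a z \<equiv> inv' (scale z one - a)"

lemma resolvent_unit: "alg_spectrum scale mult one a = {} \<Longrightarrow> scale z one - a \<in> units"
  by (auto simp: alg_spectrum_def)

section \<open>The resolvent composed with a continuous functional\<close>

context
  fixes f :: "'a \<Rightarrow> complex"
  assumes f: "f \<in> topological_dual scale"
begin

lemma functional_scale: "f (scale z b) = z * f b"
  and functional_diff: "f (b - c) = f b - f c"
proof -
  interpret Vector_Spaces.linear scale "(*)" f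
    using f by (simp add: topological_dual_def)
  show "f (scale z b) = z * f b" "f (b - c) = f b - f c"
    by (fact scale diff)+
qed

lemma functional_tendsto: "(g \<longlongrightarrow> l) F \<Longrightarrow> ((\<lambda>x. f (g x)) \<longlongrightarrow> f l) F"
  using f continuous_on_tendsto_compose[of UNIV f g l F] by (simp add: topological_dual_def)

lemma functional_zero: "f 0 = 0"
  using functional_diff[of 0 0] by simp

context
  fixes a :: 'a
  assumes empty: "alg_spectrum scale mult one a = {}"
begin

private abbreviation R where "R z \<equiv> resolvent a z"

private lemmas unit = resolvent_unit[OF empty]

lemma continuous_on_resolvent: "continuous_on UNIV R"
  using unit
  by (intro continuous_on_compose2[OF continuous_inverse] continuous_on_diff
      continuous_on_scale_left continuous_on_const) auto

text \<open>By the resolvent equation the difference quotient is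
  \<open>- f (R z \<odot> R w)\<close>. Only the left factor moves with \<open>z\<close>, so the
  limit follows from continuity of multiplication in that factor and of the resolvent.\<close>

lemma resolvent_has_derivative:
  "((\<lambda>z. f (R z)) has_field_derivative - f (R w \<odot> R w)) (at w)"
proof -
  have "(R \<longlongrightarrow> R w) (at w)"
    using continuous_on_resolvent by (simp add: continuous_on_def)
  then have "((\<lambda>z. R z \<odot> R w) \<longlongrightarrow> R w \<odot> R w) (at w)"
    using continuous_on_tendsto_compose[OF continuous_mult_left] by simp
  then have lim: "((\<lambda>z. - f (R z \<odot> R w)) \<longlongrightarrow> - f (R w \<odot> R w)) (at w)"
    by (intro tendsto_minus functional_tendsto)
  have "- f (R z \<odot> R w) = (f (R z) - f (R w)) / (z - w)"
    if "z \<noteq> w" for z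
  proof -
    have "f (R z) - f (R w) = (w - z) * f (R z \<odot> R w)"
      using resolvent_equation[OF unit unit, of z w]
      by (metis functional_diff functional_scale)
    then show ?thesis using that by (simp add: field_simps)
  qed
  then have "\<forall>\<^sub>F z in at w. - f (R z \<odot> R w) =
      (f (R z) - f (R w)) / (z - w)"
    by (auto simp: eventually_at_filter)
  from Lim_transform_eventually[OF lim this] show ?thesis
    by (simp add: has_field_derivative_iff)
qed

text \<open>For nonzero \<open>z\<close>, \<open>R z\<close> is \<open>inverse z\<close> times the
  inverse of \<open>one - scale (inverse z) a\<close>. The latter inverse tends to
  \<open>one\<close> while the scalar tends to 0.\<close>

lemma resolvent_vanishes_at_infinity: "((\<lambda>z. f (R z)) \<longlongrightarrow> 0) at_infinity"
proof -
  have one: "one \<in> units" "inv' one = one"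
    using unitI[of one one] by (simp_all add: mult_one)
  have "((\<lambda>z. scale (inverse z) a) \<longlongrightarrow> scale 0 a) at_infinity"
    using continuous_on_tendsto_compose[OF continuous_on_scale_left[of UNIV a] tendsto_inverse_0]
    by simp
  then have "((\<lambda>z. one - scale (inverse z) a) \<longlongrightarrow> one - scale 0 a) at_infinity"
    by (intro tendsto_diff tendsto_const)
  then have "((\<lambda>z. one - scale (inverse z) a) \<longlongrightarrow> one) at_infinity"
    by simp
  moreover have nz: "\<forall>\<^sub>F z::complex in at_infinity. z \<noteq> 0"
    using eventually_not_equal_at_infinity[of 0] by simp
  then have "\<forall>\<^sub>F z in at_infinity. one - scale (inverse z) a \<in> units"
    by eventually_elim (use inverse_scaled(1)[OF unit] in blast)
  ultimately have "((\<lambda>z. inv' (one - scale (inverse z) a)) \<longlongrightarrow> one) at_infinity"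
    using continuous_on_tendsto_compose[OF continuous_inverse] one by metis
  then have "((\<lambda>z. inverse z * f (inv' (one - scale (inverse z) a))) \<longlongrightarrow> 0 * f one) at_infinity"
    by (intro tendsto_mult tendsto_inverse_0 functional_tendsto)
  moreover have "\<forall>\<^sub>F z in at_infinity.
      inverse z * f (inv' (one - scale (inverse z) a)) = f (R z)"
    using nz by eventually_elim
      (simp add: inverse_scaled(2)[OF unit] functional_scale)
  ultimately show ?thesis
    using Lim_transform_eventually by fastforce
qed

lemma functional_resolvent_eq_0: "f (R z) = 0"
proof (rule Liouville_weak[OF _ resolvent_vanishes_at_infinity])
  show "(\<lambda>z. f (R z)) holomorphic_on UNIV"
    using resolvent_has_derivative
    by (auto simp: holomorphic_on_open)
qed

end

end

theorem alg_spectrum_nonempty: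
  assumes "dual_separates_points scale"
  shows "alg_spectrum scale mult one a \<noteq> {}"
proof
  assume empty: "alg_spectrum scale mult one a = {}"
  \<comment> \<open>Every continuous functional kills the resolvent at every point; 0 is an
    arbitrary choice. Separation of points then makes this inverse zero, although its product with
    \<open>scale 0 one - a\<close> is \<open>one\<close>.\<close>
  have "resolvent a 0 = 0"
    using assms functional_resolvent_eq_0[OF _ empty, of _ 0] functional_zero
    unfolding dual_separates_points_def by metis
  then show False
    using alg_inverse_mult(1)[OF resolvent_unit[OF empty], of 0] one_neq_zero
    by (simp add: right_mult_zero)
qed

end

section \<open>The Hahn--Banach theorem for seminorms\<close>

text \<open>The two indices vary independently, so the infimum can be taken over \<open>i\<close>
  with \<open>j\<close> fixed and then over \<open>j\<close>. This gives subadditivity of infima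
  below.\<close>

lemma add_INF_ge:
  fixes f g :: "'i \<Rightarrow> real"
  assumes "I \<noteq> {}" and le: "\<And>i j. i \<in> I \<Longrightarrow> j \<in> I \<Longrightarrow> c \<le> f i + g j"
  shows "c \<le> (INF i\<in>I. f i) + (INF i\<in>I. g i)"
proof -
  have "c - (INF i\<in>I. f i) \<le> g j" if "j \<in> I" for j
  proof -
    have "c - g j \<le> (INF i\<in>I. f i)"
      by (rule cINF_greatest) (use assms that in \<open>auto simp: algebra_simps\<close>)
    then show ?thesis by simp
  qed
  then have "c - (INF i\<in>I. f i) \<le> (INF i\<in>I. g i)"
    by (intro cINF_greatest assms)
  then show ?thesis by simp
qed

text \<open>The real scalar multiplication is a parameter, so that a complex space with scalars
  restricted to the reals is an instance.\<close>

locale real_vector_structure = vector_space scale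
  for scale :: "real \<Rightarrow> 'a::ab_group_add \<Rightarrow> 'a"
begin

text \<open>Positive homogeneity is stated as an inequality, the form that is easy to check for
  infima; equality is recovered in \<open>sublinear_scale\<close>.\<close>

definition sublinear :: "('a \<Rightarrow> real) \<Rightarrow> bool" where
  "sublinear q \<longleftrightarrow>
    (\<forall>x y. q (x + y) \<le> q x + q y) \<and> (\<forall>r x. 0 \<le> r \<longrightarrow> q (scale r x) \<le> r * q x)"

lemma sublinear_add: "sublinear q \<Longrightarrow> q (x + y) \<le> q x + q y"
  and sublinear_scale_le: "sublinear q \<Longrightarrow> 0 \<le> r \<Longrightarrow> q (scale r x) \<le> r * q x"
  by (auto simp: sublinear_def)

lemma sublinear_zero:
  assumes "sublinear q"
  shows "q 0 = 0"
  using sublinear_add[OF assms, of 0 0] sublinear_scale_le[OF assms, of 0 0] by simp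

lemma sublinear_minus:
  assumes "sublinear q"
  shows "- q (- x) \<le> q x"
  using sublinear_add[OF assms, of x "- x"] sublinear_zero[OF assms] by simp

lemma sublinear_scale:
  assumes "sublinear q" "0 \<le> r"
  shows "q (scale r x) = r * q x"
proof (cases "r = 0")
  case False
  then have "q x \<le> inverse r * q (scale r x)"
    using sublinear_scale_le[OF assms(1), of "inverse r" "scale r x"] assms(2) by simp
  then have "r * q x \<le> q (scale r x)"
    using False assms(2) by (simp add: field_simps)
  then show ?thesis
    using sublinear_scale_le[OF assms] by (simp add: order_antisym)
qed (simp add: sublinear_zero[OF assms(1)])

text \<open>The index \<open>k\<close> may depend on the arguments. This covers two uses: the family
  in \<open>linearize_along\<close>, where the parameters add and scale, and a chain of functionals,
  where \<open>k\<close> is the smaller of two members.\<close>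

lemma sublinear_INF:
  fixes g :: "'i \<Rightarrow> 'a \<Rightarrow> real"
  assumes ne: "I \<noteq> {}" and bdd: "\<And>x. bdd_below ((\<lambda>i. g i x) ` I)"
    and add: "\<And>i j x y. i \<in> I \<Longrightarrow> j \<in> I \<Longrightarrow> \<exists>k\<in>I. g k (x + y) \<le> g i x + g j y"
    and scale: "\<And>i r x. i \<in> I \<Longrightarrow> 0 \<le> r \<Longrightarrow> \<exists>k\<in>I. g k (scale r x) \<le> r * g i x"
  shows "sublinear (\<lambda>x. INF i\<in>I. g i x)"
  unfolding sublinear_def
proof (intro conjI allI impI)
  fix x y
  show "(INF i\<in>I. g i (x + y)) \<le> (INF i\<in>I. g i x) + (INF i\<in>I. g i y)"
  proof (rule add_INF_ge[OF ne])
    fix i j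
    assume "i \<in> I" "j \<in> I"
    then obtain k where "k \<in> I" "g k (x + y) \<le> g i x + g j y"
      using add by blast
    then show "(INF i\<in>I. g i (x + y)) \<le> g i x + g j y"
      by (rule cINF_lower2[OF bdd])
  qed
next
  fix r :: real and x
  assume r: "0 \<le> r"
  have le: "(INF i\<in>I. g i (scale r x)) \<le> r * g i x" if "i \<in> I" for i
  proof -
    obtain k where "k \<in> I" "g k (scale r x) \<le> r * g i x"
      using scale[OF \<open>i \<in> I\<close> r] by blast
    then show ?thesis
      by (rule cINF_lower2[OF bdd])
  qed
  show "(INF i\<in>I. g i (scale r x)) \<le> r * (INF i\<in>I. g i x)"
  proof (cases "r = 0")
    case True
    obtain i where "i \<in> I" using ne by blast
    from le[OF this] show ?thesis by (simp only: True mult_zero_left)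
  next
    case False
    then have "(INF i\<in>I. g i (scale r x)) / r \<le> (INF i\<in>I. g i x)"
      using le r by (intro cINF_greatest ne) (simp add: field_simps)
    then show ?thesis using False r by (simp add: field_simps)
  qed
qed

text \<open>The largest sublinear functional \<open>q' \<le> q\<close> with \<open>q' (- y) \<le> - q y\<close>.  A minimal
  sublinear functional is fixed by this construction for every \<open>y\<close>, hence linear.\<close>

definition linearize_along :: "('a \<Rightarrow> real) \<Rightarrow> 'a \<Rightarrow> 'a \<Rightarrow> real" where
  "linearize_along q y x = (INF t\<in>{0..}. q (x + scale t y) - t * q y)"

context
  fixes q :: "'a \<Rightarrow> real" and y :: 'a
  assumes q: "sublinear q"
begin

text \<open>Write \<open>scale t y\<close> as the sum of \<open>x + scale t y\<close> and
  \<open>- x\<close>, and use \<open>q (scale t y) = t * q y\<close>.\<close>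

lemma linearize_along_bdd: "bdd_below ((\<lambda>t. q (x + scale t y) - t * q y) ` {0..})"
proof (rule bdd_belowI2)
  fix t :: real
  assume "t \<in> {0..}"
  then show "- q (- x) \<le> q (x + scale t y) - t * q y"
    using sublinear_add[OF q, of "x + scale t y" "- x"] sublinear_scale[OF q, of t y] by simp
qed

lemma linearize_along_le: "0 \<le> t \<Longrightarrow> linearize_along q y x \<le> q (x + scale t y) - t * q y"
  unfolding linearize_along_def by (rule cINF_lower[OF linearize_along_bdd]) simp

lemma linearize_along_le_self: "linearize_along q y x \<le> q x"
  using linearize_along_le[of 0 x] by simp

lemma linearize_along_minus: "linearize_along q y (- y) \<le> - q y"
  using linearize_along_le[of 1 "- y"] sublinear_zero[OF q] by simp

lemma sublinear_linearize_along: "sublinear (linearize_along q y)"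
  unfolding linearize_along_def
proof (rule sublinear_INF)
  fix s t :: real and u v
  assume st: "s \<in> {0..}" "t \<in> {0..}"
  have "q (u + v + scale (s + t) y) \<le> q (u + scale s y) + q (v + scale t y)"
    using sublinear_add[OF q, of "u + scale s y" "v + scale t y"]
    by (simp add: scale_left_distrib algebra_simps)
  then show "\<exists>k\<in>{0..}. q (u + v + scale k y) - k * q y \<le>
      q (u + scale s y) - s * q y + (q (v + scale t y) - t * q y)"
    using st by (intro bexI[of _ "s + t"]) (auto simp: algebra_simps)
next
  fix t r :: real and u
  assume "t \<in> {0..}" "0 \<le> r"
  then show "\<exists>k\<in>{0..}. q (scale r u + scale k y) - k * q y \<le> r * (q (u + scale t y) - t * q y)"
    using sublinear_scale_le[OF q, of r "u + scale t y"]
    by (intro bexI[of _ "r * t"]) (auto simp: scale_right_distrib algebra_simps)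
qed (use linearize_along_bdd in auto)

end

text \<open>Zorn's lemma for the reversed pointwise order; a nonempty chain is bounded below by its
  pointwise infimum.\<close>

lemma minimal_sublinear:
  assumes p: "sublinear p"
  obtains m where "sublinear m" "m \<le> p" "\<And>q. sublinear q \<Longrightarrow> q \<le> m \<Longrightarrow> q = m"
proof -
  define A where "A = {q. sublinear q \<and> q \<le> p}"
  have "\<exists>m\<in>A. \<forall>a\<in>A. a \<le> m \<longrightarrow> a = m"
  proof (rule predicate_Zorn)
    show "partial_order_on A (relation_of (\<lambda>q q'. q' \<le> q) A)"
      by (rule partial_order_on_relation_ofI) auto
  next
    fix C
    assume C: "C \<in> Chains (relation_of (\<lambda>q q'. q' \<le> q) A)"
    show "\<exists>u\<in>A. \<forall>a\<in>C. u \<le> a"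
    proof (cases "C = {}")
      case True
      then show ?thesis using p by (auto simp: A_def)
    next
      case False
      have CA: "C \<subseteq> A" and chain: "\<And>a b. a \<in> C \<Longrightarrow> b \<in> C \<Longrightarrow> a \<le> b \<or> b \<le> a"
        using C by (auto simp: Chains_def relation_of_def)
      have sub: "sublinear q" and le: "q x \<le> p x" if "q \<in> C" for q x
        using CA that by (auto simp: A_def le_fun_def)
      have bdd: "bdd_below ((\<lambda>q. q x) ` C)" for x
      proof (rule bdd_belowI2)
        fix q
        assume "q \<in> C"
        \<comment> \<open>The bound \<open>- q (- x) \<le> q x\<close> is weakened by
          \<open>q \<le> p\<close> to one that is the same for all members of the chain.\<close>
        then show "- p (- x) \<le> q x"
          using sublinear_minus[OF sub, of q x] le[of q "- x"] by simp
      qed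
      have "sublinear (\<lambda>x. INF q\<in>C. q x)"
      proof (rule sublinear_INF[OF False bdd])
        fix a b x y
        assume ab: "a \<in> C" "b \<in> C"
        then obtain k where k: "k \<in> C" "k \<le> a" "k \<le> b"
          using chain by blast
        have "k (x + y) \<le> a x + b y"
          using sublinear_add[OF sub[OF k(1)], of x y] k(2,3)
          by (meson add_mono le_funD order_trans)
        then show "\<exists>k\<in>C. k (x + y) \<le> a x + b y" using k(1) by blast
      qed (use sub sublinear_scale_le in blast)
      moreover have lower: "(\<lambda>x. INF q\<in>C. q x) \<le> a" if "a \<in> C" for a
        by (auto intro!: le_funI cINF_lower bdd that)
      moreover have "(\<lambda>x. INF q\<in>C. q x) \<le> p"
        using False lower CA unfolding A_def by (blast intro: order_trans)
      ultimately show ?thesis unfolding A_def by blast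
    qed
  qed
  then obtain m where "m \<in> A" "\<And>a. a \<in> A \<Longrightarrow> a \<le> m \<Longrightarrow> a = m" by blast
  then show ?thesis
    using that[of m] unfolding A_def by (blast intro: order_trans)
qed

text \<open>Minimal sublinear functionals are linear. Taking one below
  \<open>linearize_along p x\<^sub>0\<close> instead of \<open>p\<close> itself also forces
  \<open>u (- x\<^sub>0) \<le> - p x\<^sub>0\<close>, which is the lower bound at
  \<open>x\<^sub>0\<close>.\<close>

theorem Hahn_Banach_sublinear:
  assumes p: "sublinear p"
  obtains u where "\<And>x y. u (x + y) = u x + u y" "\<And>r x. u (scale r x) = r * u x"
    "\<And>x. u x \<le> p x" "p x\<^sub>0 \<le> u x\<^sub>0"
proof -
  obtain u where u: "sublinear u" and le: "u \<le> linearize_along p x\<^sub>0"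
    and minimal: "\<And>q. sublinear q \<Longrightarrow> q \<le> u \<Longrightarrow> q = u"
    using minimal_sublinear[OF sublinear_linearize_along[OF p]] by metis
  have "linearize_along u y = u" for y
    using minimal sublinear_linearize_along[OF u] linearize_along_le_self[OF u]
    by (simp add: le_fun_def)
  \<comment> \<open>With \<open>t = 1\<close>, minimality reads
    \<open>u x \<le> u (x + y) - u y\<close>, the reverse of subadditivity.\<close>
  then have add: "u (x + y) = u x + u y" for x y
    using linearize_along_le[OF u, of 1 y x] sublinear_add[OF u, of x y] by simp
  have minus: "u (- x) = - u x" for x
    using add[of x "- x"] sublinear_zero[OF u] by simp
  have "u (scale r x) = r * u x" for r x
  proof (cases "0 \<le> r")
    case False
    then show ?thesis
      using sublinear_scale[OF u, of "- r" x] minus by simp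
  qed (rule sublinear_scale[OF u])
  moreover have "u x \<le> p x" for x
    using le linearize_along_le_self[OF p] by (meson le_funD order_trans)
  moreover have "p x\<^sub>0 \<le> u x\<^sub>0"
    using le linearize_along_minus[OF p, of x\<^sub>0] minus[of x\<^sub>0]
    by (smt (verit) le_funD)
  ultimately show ?thesis using add that by blast
qed

end

section \<open>Topologies generated by seminorms\<close>

locale seminorm_topology = vector_space scale
  for scale :: "complex \<Rightarrow> 'a::{topological_ab_group_add, t2_space} \<Rightarrow> 'a" +
  fixes P :: "('a \<Rightarrow> real) set"
  assumes seminorm: "p \<in> P \<Longrightarrow> complex_seminorm scale p"
    and generated: "topology_generated_by_seminorms P"
begin

lemma seminorm_add: "p \<in> P \<Longrightarrow> p (x + y) \<le> p x + p y"
  and seminorm_scale: "p \<in> P \<Longrightarrow> p (scale z x) = cmod z * p x"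
  using seminorm by (auto simp: complex_seminorm_def)

lemma seminorm_zero: "p \<in> P \<Longrightarrow> p 0 = 0"
  using seminorm_scale[of p 0 0] by simp

lemma seminorm_minus: "p \<in> P \<Longrightarrow> p (- x) = p x"
  using seminorm_scale[of p "-1" x] by simp

lemma seminorm_nonneg: "p \<in> P \<Longrightarrow> 0 \<le> p x"
  using seminorm_add[of p x "- x"] by (simp add: seminorm_zero seminorm_minus)

text \<open>Balls around \<open>l\<close> are open, which gives one direction. Conversely, a
  subbasic ball \<open>{y. p (y - x) < e}\<close> containing \<open>l\<close> contains the ball of
  radius \<open>e - p (l - x)\<close> around \<open>l\<close>, and induction over
  \<open>generate_topology\<close> extends this to all open sets.\<close>

lemma tendsto_iff_seminorms:
  "(g \<longlongrightarrow> l) F \<longleftrightarrow> (\<forall>p\<in>P. ((\<lambda>x. p (g x - l)) \<longlongrightarrow> 0) F)"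
proof
  assume lim: "(g \<longlongrightarrow> l) F"
  show "\<forall>p\<in>P. ((\<lambda>x. p (g x - l)) \<longlongrightarrow> 0) F"
  proof
    fix p
    assume p: "p \<in> P"
    show "((\<lambda>x. p (g x - l)) \<longlongrightarrow> 0) F"
    proof (rule order_tendstoI)
      fix e :: real
      assume "e < 0"
      then show "\<forall>\<^sub>F x in F. e < p (g x - l)"
        using seminorm_nonneg[OF p] by (intro always_eventually) (meson less_le_trans)
    next
      fix e :: real
      assume e: "0 < e"
      have "open {y. p (y - l) < e}"
        unfolding generated[unfolded topology_generated_by_seminorms_def]
        using p e by (intro generate_topology.Basis) blast
      moreover have "l \<in> {y. p (y - l) < e}"
        using e by (simp add: seminorm_zero[OF p])
      ultimately show "\<forall>\<^sub>F x in F. p (g x - l) < e"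
        using topological_tendstoD[OF lim] by fastforce
    qed
  qed
next
  assume lim: "\<forall>p\<in>P. ((\<lambda>x. p (g x - l)) \<longlongrightarrow> 0) F"
  have "l \<in> S \<longrightarrow> (\<forall>\<^sub>F x in F. g x \<in> S)"
    if "generate_topology {{y. p (y - x) < e} | p x e. p \<in> P \<and> 0 < e} S" for S
    using that
  proof induction
    case (Int S T)
    then show ?case by (auto intro: eventually_conj)
  next
    case (UN K)
    then show ?case by (auto intro: eventually_mono[where P = "\<lambda>x. g x \<in> _"])
  next
    case (Basis S)
    then obtain p x e where S: "S = {y. p (y - x) < e}" and p: "p \<in> P" by blast
    show ?case
    proof
      assume "l \<in> S"
      then have "0 < e - p (l - x)" by (simp add: S)
      then have "\<forall>\<^sub>F y in F. p (g y - l) < e - p (l - x)"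
        using order_tendstoD(2)[OF bspec[OF lim p]] by simp
      then show "\<forall>\<^sub>F y in F. g y \<in> S"
      proof eventually_elim
        case (elim y)
        then show ?case
          using seminorm_add[OF p, of "g y - l" "l - x"] by (simp add: S)
      qed
    qed
  qed simp
  then show "(g \<longlongrightarrow> l) F"
    using generated unfolding topology_generated_by_seminorms_def
    by (metis topological_tendstoI)
qed

lemma tendsto_seminorm: "(g \<longlongrightarrow> l) F \<Longrightarrow> p \<in> P \<Longrightarrow> ((\<lambda>x. p (g x - l)) \<longlongrightarrow> 0) F"
  by (simp add: tendsto_iff_seminorms)

text \<open>Squeeze form of the criterion, in which continuity of the algebra operations is checked
  one seminorm at a time.\<close>

lemma tendsto_seminorm_bound:
  assumes "\<And>p. p \<in> P \<Longrightarrow> \<exists>h. (h \<longlongrightarrow> 0) F \<and> (\<forall>\<^sub>F x in F. p (g x - l) \<le> h x)"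
  shows "(g \<longlongrightarrow> l) F"
  unfolding tendsto_iff_seminorms
proof
  fix p
  assume p: "p \<in> P"
  from assms[OF p] obtain h
    where h: "(h \<longlongrightarrow> 0) F" "\<forall>\<^sub>F x in F. p (g x - l) \<le> h x"
    by (elim exE conjE)
  have "\<forall>\<^sub>F x in F. 0 \<le> p (g x - l)"
    by (simp add: seminorm_nonneg[OF p])
  from tendsto_sandwich[OF this h(2) tendsto_const h(1)] show "((\<lambda>x. p (g x - l)) \<longlongrightarrow> 0) F" .
qed

lemma continuous_scale: "continuous_on UNIV (\<lambda>(z, a). scale z a)"
  unfolding continuous_on_def
proof (clarify, rule tendsto_seminorm_bound)
  fix z :: complex and a :: 'a and p
  assume p: "p \<in> P"
  let ?F = "at (z, a) within UNIV"
  \<comment> \<open>The bound comes from splitting the difference of \<open>scale w x\<close> and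
    \<open>scale z a\<close> as \<open>scale w (x - a) + scale (w - z) a\<close>.\<close>
  let ?h = "\<lambda>x. cmod (fst x) * p (snd x - a) + cmod (fst x - z) * p a"
  have fst: "(fst \<longlongrightarrow> z) ?F" and snd: "(snd \<longlongrightarrow> a) ?F"
    using tendsto_fst[OF tendsto_ident_at, of "(z, a)"] tendsto_snd[OF tendsto_ident_at, of "(z, a)"]
    by simp_all
  have "((\<lambda>x. p (snd x - a)) \<longlongrightarrow> 0) ?F"
    by (rule tendsto_seminorm[OF snd p])
  then have "(?h \<longlongrightarrow> cmod z * 0 + cmod (z - z) * p a) ?F"
    by (intro tendsto_intros fst)
  moreover have "p ((case x of (z, a) \<Rightarrow> scale z a) - scale z a) \<le> ?h x" for x
  proof -
    have "scale (fst x) (snd x) - scale z a = scale (fst x) (snd x - a) + scale (fst x - z) a"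
      by (simp add: scale_left_diff_distrib scale_right_diff_distrib)
    then show ?thesis
      using seminorm_add[OF p, of "scale (fst x) (snd x - a)" "scale (fst x - z) a"]
      by (simp add: case_prod_beta seminorm_scale[OF p])
  qed
  ultimately show "\<exists>h. (h \<longlongrightarrow> 0) ?F \<and>
      (\<forall>\<^sub>F x in ?F. p ((case x of (z, a) \<Rightarrow> scale z a) - scale z a) \<le> h x)"
    by (intro exI[of _ ?h]) simp
qed

text \<open>Otherwise the constant sequence \<open>x\<close> would converge to \<open>y\<close>,
  against the Hausdorff property.\<close>

lemma seminorms_separate_points:
  assumes "x \<noteq> y"
  shows "\<exists>p\<in>P. p (x - y) \<noteq> 0"
proof (rule ccontr)
  assume "\<not> ?thesis"
  then have "(\<lambda>_::nat. x) \<longlonglongrightarrow> y"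
    unfolding tendsto_iff_seminorms by fastforce
  then show False using assms by (simp add: LIMSEQ_const_iff)
qed

lemma dominated_functional_continuous:
  assumes f: "Vector_Spaces.linear scale (*) f" and p: "p \<in> P"
    and le: "\<And>x. cmod (f x) \<le> c * p x"
  shows "f \<in> topological_dual scale"
proof -
  interpret Vector_Spaces.linear scale "(*)" f by (rule f)
  have "(f \<longlongrightarrow> f l) (at l)" for l
  proof (rule Lim_null_comparison[THEN Lim_null[THEN iffD2]])
    show "\<forall>\<^sub>F x in at l. norm (f x - f l) \<le> c * p (x - l)"
      using le by (metis (no_types, lifting) always_eventually diff)
    have "((\<lambda>x. p (x - l)) \<longlongrightarrow> 0) (at l)"
      by (rule tendsto_seminorm[OF tendsto_ident_at p])
    then show "((\<lambda>x. c * p (x - l)) \<longlongrightarrow> 0) (at l)"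
      by (rule tendsto_mult_right_zero)
  qed
  then show ?thesis
    using f by (simp add: topological_dual_def continuous_on_def)
qed

lemma real_vector_structure_of_real: "real_vector_structure (\<lambda>r. scale (of_real r))"
  by unfold_locales (simp_all add: scale_left_distrib scale_right_distrib)

text \<open>Choose a seminorm in \<open>P\<close> that is nonzero at \<open>x - y\<close>, take a
  real-linear functional below it attaining its value there, and complexify.\<close>

theorem dual_separates_points: "dual_separates_points scale"
  unfolding dual_separates_points_def
proof (intro allI impI)
  fix x y :: 'a
  assume "x \<noteq> y"
  then obtain p where p: "p \<in> P" and nz: "p (x - y) \<noteq> 0"
    using seminorms_separate_points by blast
  interpret R: real_vector_structure "\<lambda>r. scale (of_real r)"
    by (rule real_vector_structure_of_real)
  have "R.sublinear p"
    by (simp add: R.sublinear_def seminorm_add[OF p] seminorm_scale[OF p])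
  then obtain u where add: "\<And>v w. u (v + w) = u v + u w"
    and hom: "\<And>r v. u (scale (of_real r) v) = r * u v"
    and le: "\<And>v. u v \<le> p v" and ge: "p (x - y) \<le> u (x - y)"
    using R.Hahn_Banach_sublinear by metis
  have minus: "u (- v) = - u v" for v
    using hom[of "-1" v] by simp
  have abs_le: "\<bar>u v\<bar> \<le> p v" for v
    using le[of v] le[of "- v"] by (simp add: minus seminorm_minus[OF p])
  have cartesian: "u (scale z v) = Re z * u v + Im z * u (scale \<i> v)" for z v
  proof -
    have "scale z v = scale (of_real (Re z)) v + scale (of_real (Im z)) (scale \<i> v)"
      by (metis complex_eq mult.commute scale_left_distrib scale_scale)
    then show ?thesis by (simp only: add hom)
  qed
  \<comment> \<open>The complex-linear functional with real part \<open>u\<close>, that is,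
    \<open>u v - \<i> * u (scale \<i> v)\<close>.\<close>
  define f where "f v = Complex (u v) (- u (scale \<i> v))" for v
  have "f (v + w) = f v + f w" for v w
    by (simp add: f_def add scale_right_distrib complex_eq_iff)
  moreover have "f (scale z v) = z * f v" for z v
  proof -
    have "scale \<i> (scale z v) = scale (\<i> * z) v" by simp
    then show ?thesis
      by (simp add: f_def cartesian[of z] cartesian[of "\<i> * z"] complex_eq_iff algebra_simps
          del: scale_scale)
  qed
  ultimately have lin: "Vector_Spaces.linear scale (*) f"
    by unfold_locales (simp_all add: algebra_simps)
  \<comment> \<open>The real and imaginary parts each contribute at most \<open>p v\<close>, since
    \<open>p (scale \<i> v) = p v\<close>.\<close>
  have "cmod (f v) \<le> 2 * p v" for v
    using cmod_le[of "f v"] abs_le[of v] abs_le[of "scale \<i> v"]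
    by (simp add: f_def seminorm_scale[OF p])
  then have "f \<in> topological_dual scale"
    using dominated_functional_continuous[OF lin p] by blast
  moreover have "f x \<noteq> f y"
  proof
    assume "f x = f y"
    then have "u (x - y) = 0"
      using add[of x "- y"] minus[of y] by (simp add: f_def)
    then show False using ge nz seminorm_nonneg[OF p, of "x - y"] by simp
  qed
  ultimately show "\<exists>f\<in>topological_dual scale. f x \<noteq> f y" by blast
qed

end

section \<open>Left alternative lmc algebras are topological algebras\<close>

locale lmc_left_alternative_algebra =
  left_alternative_algebra scale mult one + seminorm_topology scale P
  for scale :: "complex \<Rightarrow> 'a::{topological_ab_group_add, t2_space} \<Rightarrow> 'a"
    and mult :: "'a \<Rightarrow> 'a \<Rightarrow> 'a" (infixl \<open>\<odot>\<close> 70)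
    and one :: 'a
    and P :: "('a \<Rightarrow> real) set" +
  assumes submultiplicative: "p \<in> P \<Longrightarrow> submultiplicative mult p"
begin

lemma seminorm_mult: "p \<in> P \<Longrightarrow> p (a \<odot> b) \<le> p a * p b"
  using submultiplicative by (simp add: submultiplicative_def)

lemma tendsto_seminorm_at: "p \<in> P \<Longrightarrow> ((\<lambda>x. p (x - a)) \<longlongrightarrow> 0) (at a within S)"
  by (rule tendsto_seminorm[OF tendsto_ident_at])

lemma continuous_mult_right: "continuous_on UNIV (\<lambda>b. a \<odot> b)"
  unfolding continuous_on_def
proof (intro ballI tendsto_seminorm_bound)
  fix b p
  assume p: "p \<in> P"
  have "p (a \<odot> x - a \<odot> b) \<le> p a * p (x - b)" for x
    using seminorm_mult[OF p, of a "x - b"] by (simp add: mult_diff_right)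
  then show "\<exists>h. (h \<longlongrightarrow> 0) (at b) \<and> (\<forall>\<^sub>F x in at b. p (a \<odot> x - a \<odot> b) \<le> h x)"
    using tendsto_mult_right_zero[OF tendsto_seminorm_at[OF p]]
    by (intro exI[of _ "\<lambda>x. p a * p (x - b)"]) simp
qed

lemma continuous_mult_left: "continuous_on UNIV (\<lambda>a. a \<odot> b)"
  unfolding continuous_on_def
proof (intro ballI tendsto_seminorm_bound)
  fix a p
  assume p: "p \<in> P"
  have "p (x \<odot> b - a \<odot> b) \<le> p (x - a) * p b" for x
    using seminorm_mult[OF p, of "x - a" b] by (simp add: mult_diff_left)
  then show "\<exists>h. (h \<longlongrightarrow> 0) (at a) \<and> (\<forall>\<^sub>F x in at a. p (x \<odot> b - a \<odot> b) \<le> h x)"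
    using tendsto_mult_left_zero[OF tendsto_seminorm_at[OF p]]
    by (intro exI[of _ "\<lambda>x. p (x - a) * p b"]) simp
qed

text \<open>An absorption argument: with \<open>?c\<close>, \<open>?b\<close>, \<open>?e\<close> as
  in the proof, \<open>inverse_diff\<close> gives
  \<open>?c \<le> p (inv' x) * ?e \<le> (?c + ?b) * ?e\<close>, and \<open>?e \<le> 1 / 2\<close>
  allows the term \<open>?c * ?e\<close> to be moved to the left.\<close>

lemma seminorm_inverse_diff:
  assumes p: "p \<in> P" and a: "a \<in> units" and x: "x \<in> units"
    and small: "p (x - a) * p (inv' a) \<le> 1 / 2"
  shows "p (inv' x - inv' a) \<le> 2 * p (inv' a) * (p (x - a) * p (inv' a))"
proof -
  let ?c = "p (inv' x - inv' a)" and ?b = "p (inv' a)" and ?e = "p (x - a) * p (inv' a)"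
  have "p (a - x) = p (x - a)"
    using seminorm_minus[OF p, of "x - a"] by simp
  then have "p ((a - x) \<odot> inv' a) \<le> ?e"
    using seminorm_mult[OF p, of "a - x"] by metis
  then have "?c \<le> p (inv' x) * ?e"
    unfolding inverse_diff[OF x a]
    using seminorm_mult[OF p, of "inv' x"] seminorm_nonneg[OF p]
    by (meson mult_left_mono order_trans)
  also have "p (inv' x) \<le> ?c + ?b"
    using seminorm_add[OF p, of "inv' x - inv' a" "inv' a"] by simp
  then have "p (inv' x) * ?e \<le> (?c + ?b) * ?e"
    using seminorm_nonneg[OF p] by (intro mult_right_mono) simp_all
  also have "\<dots> \<le> ?c * (1 / 2) + ?b * ?e"
    using mult_left_mono[OF small seminorm_nonneg[OF p, of "inv' x - inv' a"]]
    by (simp add: distrib_right)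
  finally show ?thesis by simp
qed

lemma continuous_inverse: "continuous_on units inv'"
  unfolding continuous_on_def
proof (intro ballI tendsto_seminorm_bound)
  fix a p
  assume a: "a \<in> units" and p: "p \<in> P"
  let ?F = "at a within units" and ?e = "\<lambda>x. p (x - a) * p (inv' a)"
  have e: "(?e \<longlongrightarrow> 0) ?F"
    by (rule tendsto_mult_left_zero[OF tendsto_seminorm_at[OF p]])
  then have "\<forall>\<^sub>F x in ?F. ?e x < 1 / 2"
    by (rule order_tendstoD) simp
  moreover have "\<forall>\<^sub>F x in ?F. x \<in> units"
    by (simp add: eventually_at_filter)
  ultimately have "\<forall>\<^sub>F x in ?F. p (inv' x - inv' a) \<le> 2 * p (inv' a) * ?e x"
    by eventually_elim (use seminorm_inverse_diff[OF p a] in simp)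
  then show "\<exists>h. (h \<longlongrightarrow> 0) ?F \<and> (\<forall>\<^sub>F x in ?F. p (inv' x - inv' a) \<le> h x)"
    using tendsto_mult_right_zero[OF e] by blast
qed

lemma topological: "topological_unital_complex_algebra scale mult one"
  by unfold_locales
    (fact continuous_scale continuous_mult_right continuous_mult_left continuous_inverse)+

end

section \<open>Reduction to left alternative topological algebras with separating dual\<close>

context
  fixes scale :: "complex \<Rightarrow> 'a::{topological_ab_group_add, t2_space} \<Rightarrow> 'a"
    and mult :: "'a \<Rightarrow> 'a \<Rightarrow> 'a"
    and one :: 'a
begin

lemma lmc_unital_dual_separates_points:
  assumes "lmc_unital_complex_algebra scale mult one"
  shows "dual_separates_points scale"
proof -
  interpret lmc_unital_complex_algebra scale mult one by fact
  obtain P where "\<And>p. p \<in> P \<Longrightarrow> complex_seminorm scale p" "topology_generated_by_seminorms P"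
    using submultiplicative_seminorms by blast
  then interpret seminorm_topology scale P by unfold_locales
  show ?thesis by (rule dual_separates_points)
qed

lemma continuous_inverse_dual_separates_points:
  assumes "continuous_inverse_complex_algebra scale mult one"
  shows "dual_separates_points scale"
proof -
  interpret continuous_inverse_complex_algebra scale mult one by fact
  obtain P where "\<And>p. p \<in> P \<Longrightarrow> complex_seminorm scale p" "topology_generated_by_seminorms P"
    using locally_convex by blast
  then interpret seminorm_topology scale P by unfold_locales
  show ?thesis by (rule dual_separates_points)
qed

lemma lmc_left_alternative_topological:
  assumes "lmc_unital_complex_algebra scale mult one" "left_alternative mult"
  shows "topological_unital_complex_algebra scale mult one"
proof -
  interpret lmc_unital_complex_algebra scale mult one by fact
  obtain P where "\<And>p. p \<in> P \<Longrightarrow> complex_seminorm scale p"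
    "\<And>p. p \<in> P \<Longrightarrow> submultiplicative mult p" "topology_generated_by_seminorms P"
    using submultiplicative_seminorms by blast
  then interpret lmc_left_alternative_algebra scale mult one P
    using assms(2) by unfold_locales
  show ?thesis by (rule topological)
qed

lemma left_alternative_spectrum_nonempty:
  assumes "topological_unital_complex_algebra scale mult one" "left_alternative mult"
    and "dual_separates_points scale"
  shows "alg_spectrum scale mult one a \<noteq> {}"
proof -
  interpret topological_unital_complex_algebra scale mult one by fact
  interpret topological_left_alternative_algebra scale mult one
    using assms(2) by unfold_locales
  show ?thesis by (rule alg_spectrum_nonempty[OF assms(3)])
qed

end

theorem theorem3p1:
  fixes scale :: "complex \<Rightarrow> 'a::{topological_ab_group_add, t2_space} \<Rightarrow> 'a"
    and mult :: "'a \<Rightarrow> 'a \<Rightarrow> 'a"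
    and one :: 'a
  assumes "left_alternative mult \<or> right_alternative mult"
  shows "(topological_unital_complex_algebra scale mult one \<and> dual_separates_points scale \<longrightarrow>
            (\<forall>a. alg_spectrum scale mult one a \<noteq> {})) \<and>
         (lmc_unital_complex_algebra scale mult one \<or>
            continuous_inverse_complex_algebra scale mult one \<longrightarrow>
            topological_unital_complex_algebra scale mult one \<and> dual_separates_points scale)"
proof (intro conjI impI allI)
  fix a
  assume top: "topological_unital_complex_algebra scale mult one \<and> dual_separates_points scale"
  from assms show "alg_spectrum scale mult one a \<noteq> {}"
  proof
    assume "left_alternative mult"
    with top show ?thesis
      by (elim conjE) (rule left_alternative_spectrum_nonempty)
  next
    \<comment> \<open>The opposite algebra is left alternative and has the same units, inverses and
      spectra; the dual does not involve the multiplication.\<close>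
    assume "right_alternative mult"
    then have left: "left_alternative (\<lambda>a b. mult b a)"
      by (rule left_alternative_opposite[THEN iffD2])
    have "topological_unital_complex_algebra scale (\<lambda>a b. mult b a) one"
      by (rule topological_unital_complex_algebra_opposite[OF conjunct1[OF top]])
    from left_alternative_spectrum_nonempty[OF this left conjunct2[OF top]] show ?thesis
      by (simp only: alg_spectrum_opposite[of scale mult one] not_False_eq_True)
  qed
next
  assume "lmc_unital_complex_algebra scale mult one \<or>
    continuous_inverse_complex_algebra scale mult one"
  then show "topological_unital_complex_algebra scale mult one"
  proof
    assume lmc: "lmc_unital_complex_algebra scale mult one"
    from assms show ?thesis
    proof
      assume "left_alternative mult"
      with lmc show ?thesis by (rule lmc_left_alternative_topological)
    next
      assume "right_alternative mult"
      then have "left_alternative (\<lambda>a b. mult b a)"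
        by (rule left_alternative_opposite[THEN iffD2])
      with lmc_unital_complex_algebra_opposite[OF lmc]
      have "topological_unital_complex_algebra scale (\<lambda>a b. mult b a) one"
        by (rule lmc_left_alternative_topological)
      then show ?thesis
        \<comment> \<open>Passing to the opposite a second time restores
          \<open>mult\<close>.\<close>
        by (rule topological_unital_complex_algebra_opposite[of scale "\<lambda>a b. mult b a"])
    qed
  qed (simp add: continuous_inverse_complex_algebra_def)
next
  assume "lmc_unital_complex_algebra scale mult one \<or>
    continuous_inverse_complex_algebra scale mult one"
  then show "dual_separates_points scale"
    using lmc_unital_dual_separates_points continuous_inverse_dual_separates_points by blast
qed

end
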